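(* Let $(a_{i1},a_{i2})$, $i\in\{1,\ldots,m\}$, be a collection of points in $\mathbb{R}^2$ that are not all on the same line. Let $F$ be the set of all points $(x_1,\ldots,x_m)\in\mathbb{R}^m$ such that the points $(a_{i1},a_{i2},x_i)$, $i\in\{1,\ldots,m\}$, lie on the same plane in $\mathbb{R}^3$. Let $z=(z_1,\ldots,z_m)\in\mathbb{R}^m$. Then the projection $P_F z\in\mathbb{R}^m$ is given by $$(P_F z)_i=f(a_{i1},a_{i2})=\alpha+\beta a_{i1}+\gamma a_{i2}\quad\text{for all } i\in\{1,\ldots,m\},$$ where $f(t_1,t_2)=\alpha+\beta t_1+\gamma t_2$ is the least squares plane for the points $(a_{i1},a_{i2},z_i)\in\mathbb{R}^3$, $i\in\{1,\ldots,m\}$.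
   Context: $\mathbb{R}^m$ carries the standard inner product and the induced Euclidean norm $\|\cdot\|$. For a nonempty closed convex set $C\subseteq\mathbb{R}^m$, $P_C z$ denotes the unique point of $C$ minimizing $\|z-x\|$ over $x\in C$. A plane in $\mathbb{R}^3$ is a two-dimensional affine subspace. The least squares plane for points $(a_{i1},a_{i2},z_i)$, $i\in\{1,\ldots,m\}$, is the affine function $f(t_1,t_2)=\alpha+\beta t_1+\gamma t_2$ whose coefficients $(\alpha,\beta,\gamma)\in\mathbb{R}^3$ minimize $\sum_{i=1}^m(\alpha+\beta a_{i1}+\gamma a_{i2}-z_i)^2$. *)

theory Defs
  imports "HOL-Analysis.Analysis"
begin

definition is_plane :: "(real ^ 3) set \<Rightarrow> bool" where
  "is_plane P \<longleftrightarrow> affine P \<and> aff_dim P = 2"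

definition coplanar_lifts :: "('m::finite \<Rightarrow> real ^ 2) \<Rightarrow> (real ^ 'm) set" where
  "coplanar_lifts a =
     {x. \<exists>P. is_plane P \<and> (\<forall>i. (vector [a i $ 1, a i $ 2, x $ i] :: real ^ 3) \<in> P)}"

text \<open>The least squares plane is represented by the coefficients \<open>(\<alpha>, \<beta>, \<gamma>)\<close> of the affine
  function \<open>f(t\<^sub>1, t\<^sub>2) = \<alpha> + \<beta> t\<^sub>1 + \<gamma> t\<^sub>2\<close>.\<close>

definition least_squares_plane ::
  "('m::finite \<Rightarrow> real ^ 2) \<Rightarrow> real ^ 'm \<Rightarrow> real \<times> real \<times> real \<Rightarrow> bool" where
  "least_squares_plane a z c \<longleftrightarrow>
     is_arg_min (\<lambda>(\<alpha>, \<beta>, \<gamma>). \<Sum>i\<in>UNIV. (\<alpha> + \<beta> * a i $ 1 + \<gamma> * a i $ 2 - z $ i)\<^sup>2)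
       (\<lambda>_. True) c"

end

theory Submission
  imports Defs
begin

text \<open>
  The set of liftable vectors is the range of the linear map \<open>affine_values a\<close>, which sends the
  coefficients \<open>(\<alpha>, \<beta>, \<gamma>)\<close> to the values of \<open>\<alpha> + \<beta> t\<^sub>1 + \<gamma> t\<^sub>2\<close> at the points \<open>a i\<close>: a plane in
  three-space is a hyperplane \<open>n \<bullet> v = b\<close>, and a vertical one (\<open>n\<^sub>3 = 0\<close>) would force all points
  \<open>a i\<close> onto one line, so every plane that contains lifts of the \<open>a i\<close> is the graph of an affine
  function (\<open>coplanar_lifts_eq_range\<close>). The range is a subspace, hence nonempty, closed and
  convex.

  The least squares objective at \<open>c\<close> is the squared distance from \<open>z\<close> to \<open>affine_values a c\<close>, so
  \<open>c\<close> minimizes it exactly when \<open>affine_values a c\<close> is the projection of \<open>z\<close>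
  (\<open>least_squares_plane_iff\<close>). Existence and uniqueness of the minimizing coefficients follow from
  those of the projection, since \<open>affine_values a\<close> is injective, again by non-collinearity.
\<close>

text \<open>The values of the affine function \<open>\<alpha> + \<beta> t\<^sub>1 + \<gamma> t\<^sub>2\<close> at the points \<open>a i\<close>, as a function of
  its coefficients.\<close>

definition affine_values :: "('m::finite \<Rightarrow> real ^ 2) \<Rightarrow> real \<times> real \<times> real \<Rightarrow> real ^ 'm" where
  "affine_values a = (\<lambda>(\<alpha>, \<beta>, \<gamma>). \<chi> i. \<alpha> + \<beta> * a i $ 1 + \<gamma> * a i $ 2)"

lemma affine_values_nth [simp]:
  "affine_values a (\<alpha>, \<beta>, \<gamma>) $ i = \<alpha> + \<beta> * a i $ 1 + \<gamma> * a i $ 2"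
  by (simp add: affine_values_def)

lemma linear_affine_values: "linear (affine_values a)"
  by (rule linearI) (auto simp: vec_eq_iff algebra_simps)

lemma collinear_subset_line_2:
  fixes S :: "(real ^ 2) set"
  assumes "p \<noteq> 0 \<or> q \<noteq> 0" and "\<And>x. x \<in> S \<Longrightarrow> p * x $ 1 + q * x $ 2 = b"
  shows "collinear S"
proof -
  define n :: "real ^ 2" where "n = vector [p, q]"
  have "n \<noteq> 0"
    using assms(1) by (auto simp: n_def vec_eq_iff forall_2)
  have "S \<subseteq> {x. n \<bullet> x = b}"
    using assms(2) by (auto simp: n_def inner_vec_def sum_2)
  then have "aff_dim S \<le> aff_dim {x. n \<bullet> x = b}"
    by (rule aff_dim_subset)
  also have "\<dots> = 1"
    using \<open>n \<noteq> 0\<close> by simp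
  finally show ?thesis
    by (simp add: collinear_aff_dim)
qed

lemma inj_affine_values:
  assumes "\<not> collinear (range a)"
  shows "inj (affine_values a)"
  unfolding linear_injective_0[OF linear_affine_values]
proof (clarify)
  fix \<alpha> \<beta> \<gamma> assume "affine_values a (\<alpha>, \<beta>, \<gamma>) = 0"
  then have eq: "\<alpha> + \<beta> * a i $ 1 + \<gamma> * a i $ 2 = 0" for i
    by (metis affine_values_nth zero_index)
  have "\<beta> * x $ 1 + \<gamma> * x $ 2 = - \<alpha>" if "x \<in> range a" for x
  proof -
    from that obtain i where "x = a i"
      by blast
    with eq[of i] show ?thesis
      by simp
  qed
  with assms have "\<beta> = 0" "\<gamma> = 0"
    using collinear_subset_line_2 by blast+
  with eq show "(\<alpha>, \<beta>, \<gamma>) = 0"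
    by (simp add: zero_prod_def)
qed

lemma is_plane_iff_hyperplane:
  "is_plane P \<longleftrightarrow> (\<exists>n b. n \<noteq> 0 \<and> P = {v. n \<bullet> v = b})"
proof
  assume "is_plane P"
  then have "\<exists>n b. n \<noteq> 0 \<and> affine hull P = {v. n \<bullet> v = b}"
    using aff_dim_eq_hyperplane[of P] by (simp add: is_plane_def)
  moreover have "affine hull P = P"
    using \<open>is_plane P\<close> by (simp add: is_plane_def affine_hull_eq)
  ultimately show "\<exists>n b. n \<noteq> 0 \<and> P = {v. n \<bullet> v = b}"
    by (simp only:)
qed (auto simp: is_plane_def affine_hyperplane)

lemma coplanar_lifts_eq_range:
  assumes "\<not> collinear (range a)"
  shows "coplanar_lifts a = range (affine_values a)"
proof (intro equalityI subsetI)
  fix x assume "x \<in> coplanar_lifts a"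
  then obtain n :: "real ^ 3" and b where "n \<noteq> 0"
    and "\<And>i. n \<bullet> vector [a i $ 1, a i $ 2, x $ i] = b"
    by (auto simp: coplanar_lifts_def is_plane_iff_hyperplane)
  then have eq: "n $ 1 * a i $ 1 + n $ 2 * a i $ 2 + n $ 3 * x $ i = b" for i
    by (simp add: inner_vec_def sum_3)
  have "n $ 3 \<noteq> 0"
  proof
    assume "n $ 3 = 0"
    with \<open>n \<noteq> 0\<close> have "n $ 1 \<noteq> 0 \<or> n $ 2 \<noteq> 0"
      by (auto simp: vec_eq_iff forall_3)
    moreover have "n $ 1 * y $ 1 + n $ 2 * y $ 2 = b" if "y \<in> range a" for y
      using that eq \<open>n $ 3 = 0\<close> by force
    ultimately show False
      using assms collinear_subset_line_2 by blast
  qed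
  have "x $ i = b / n $ 3 + (- n $ 1 / n $ 3) * a i $ 1 + (- n $ 2 / n $ 3) * a i $ 2" for i
    using eq[of i] \<open>n $ 3 \<noteq> 0\<close> by (simp add: divide_simps) (simp add: algebra_simps)
  then have "x = affine_values a (b / n $ 3, - n $ 1 / n $ 3, - n $ 2 / n $ 3)"
    by (simp add: vec_eq_iff)
  then show "x \<in> range (affine_values a)"
    by blast
next
  fix x assume "x \<in> range (affine_values a)"
  then obtain \<alpha> \<beta> \<gamma> where x: "x = affine_values a (\<alpha>, \<beta>, \<gamma>)"
    by auto
  define n :: "real ^ 3" where "n = vector [\<beta>, \<gamma>, - 1]"
  have "n \<noteq> 0"
    by (auto simp: n_def vec_eq_iff forall_3)
  then have "is_plane {v. n \<bullet> v = - \<alpha>}"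
    using is_plane_iff_hyperplane by blast
  moreover have "vector [a i $ 1, a i $ 2, x $ i] \<in> {v. n \<bullet> v = - \<alpha>}" for i
    by (simp add: n_def x inner_vec_def sum_3)
  ultimately show "x \<in> coplanar_lifts a"
    unfolding coplanar_lifts_def by blast
qed

lemma least_squares_plane_iff_dist:
  "least_squares_plane a z c \<longleftrightarrow>
     (\<forall>d. dist z (affine_values a c) \<le> dist z (affine_values a d))"
proof -
  have "(\<lambda>(\<alpha>, \<beta>, \<gamma>). \<Sum>i\<in>UNIV. (\<alpha> + \<beta> * a i $ 1 + \<gamma> * a i $ 2 - z $ i)\<^sup>2)
      = (\<lambda>d. (dist z (affine_values a d))\<^sup>2)"
    by (auto simp: fun_eq_iff dist_vec_def L2_set_def sum_nonneg dist_real_def power2_commute)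
  then show ?thesis
    by (simp add: least_squares_plane_def is_arg_min_linorder power_mono_iff)
qed

lemma least_squares_plane_iff:
  "least_squares_plane a z c \<longleftrightarrow>
     affine_values a c = closest_point (range (affine_values a)) z"
proof -
  let ?F = "range (affine_values a)"
  have F: "subspace ?F"
    by (simp add: linear_affine_values linear_subspace_image)
  show ?thesis
  proof
    assume "least_squares_plane a z c"
    then show "affine_values a c = closest_point ?F z"
      unfolding least_squares_plane_iff_dist
      by (intro closest_point_unique subspace_imp_convex closed_subspace F) auto
  next
    assume "affine_values a c = closest_point ?F z"
    then show "least_squares_plane a z c"
      unfolding least_squares_plane_iff_dist
      using closest_point_le[OF closed_subspace[OF F]] by auto
  qed
qed

theorem theorem3p5:
  fixes a :: "'m::finite \<Rightarrow> real ^ 2" and z :: "real ^ 'm"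
  assumes "\<not> collinear (range a)"
  shows "coplanar_lifts a \<noteq> {} \<and> closed (coplanar_lifts a) \<and> convex (coplanar_lifts a)
    \<and> (\<exists>!c. least_squares_plane a z c)
    \<and> (\<forall>\<alpha> \<beta> \<gamma>. least_squares_plane a z (\<alpha>, \<beta>, \<gamma>) \<longrightarrow>
         (\<forall>i. closest_point (coplanar_lifts a) z $ i = \<alpha> + \<beta> * a i $ 1 + \<gamma> * a i $ 2))"
proof -
  have F: "coplanar_lifts a = range (affine_values a)"
    using assms by (rule coplanar_lifts_eq_range)
  then have sub: "subspace (coplanar_lifts a)"
    by (simp add: linear_affine_values linear_subspace_image)
  have ne: "coplanar_lifts a \<noteq> {}"
    by (simp add: F)
  have lsp: "least_squares_plane a z c \<longleftrightarrow> affine_values a c = closest_point (coplanar_lifts a) z"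
    for c
    by (simp add: F least_squares_plane_iff)
  have "closest_point (coplanar_lifts a) z \<in> range (affine_values a)"
    using closest_point_in_set[OF closed_subspace[OF sub] ne] F by blast
  then have "\<exists>!c. least_squares_plane a z c"
    unfolding lsp using inj_affine_values[OF assms] by (metis (no_types, lifting) injD rangeE)
  moreover have "closest_point (coplanar_lifts a) z $ i = \<alpha> + \<beta> * a i $ 1 + \<gamma> * a i $ 2"
    if "least_squares_plane a z (\<alpha>, \<beta>, \<gamma>)" for \<alpha> \<beta> \<gamma> i
    using that unfolding lsp by (metis affine_values_nth)
  ultimately show ?thesis
    using sub ne closed_subspace subspace_imp_convex by blast
qed

end
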